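(* Let $S$ be an LA-semigroup with left identity. Suppose that $L\cup R=LR$ for every left ideal $L$ of $S$ and every right ideal $R$ of $S$ such that $R$ is semiprime. Then $S$ is intra-regular.
   Context: An LA-semigroup (left almost semigroup) is a nonempty set $S$ with a binary operation, written as juxtaposition, satisfying the left invertive law $(ab)c=(cb)a$ for all $a,b,c\in S$ (associativity and commutativity are not assumed). A left identity is an element $e\in S$ with $ea=a$ for all $a\in S$. For subsets $A,B\subseteq S$, $AB=\{ab: a\in A,\ b\in B\}$. A nonempty subset $A\subseteq S$ is a left (right) ideal if $SA\subseteq A$ ($AS\subseteq A$). A nonempty subset $A\subseteq S$ is semiprime if, for $a\in S$, $a^2\in A$ implies $a\in A$, where $a^2=aa$. $S$ is intra-regular if for every $a\in S$ there exist $x,y\in S$ such that $a=(xa^{2})y$. *)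

theory Defs
  imports Main
begin

locale la_semigroup =
  fixes S :: "'a set" and mult :: "'a \<Rightarrow> 'a \<Rightarrow> 'a" (infixl "\<cdot>" 70)
  assumes nonempty: "S \<noteq> {}"
    and closed: "\<lbrakk>a \<in> S; b \<in> S\<rbrakk> \<Longrightarrow> a \<cdot> b \<in> S"
    and left_invertive: "\<lbrakk>a \<in> S; b \<in> S; c \<in> S\<rbrakk> \<Longrightarrow> (a \<cdot> b) \<cdot> c = (c \<cdot> b) \<cdot> a"

definition left_identity :: "'a set \<Rightarrow> ('a \<Rightarrow> 'a \<Rightarrow> 'a) \<Rightarrow> 'a \<Rightarrow> bool" where
  "left_identity S mult e \<longleftrightarrow> e \<in> S \<and> (\<forall>a\<in>S. mult e a = a)"

definition set_prod :: "('a \<Rightarrow> 'a \<Rightarrow> 'a) \<Rightarrow> 'a set \<Rightarrow> 'a set \<Rightarrow> 'a set" where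
  "set_prod mult A B = {mult a b | a b. a \<in> A \<and> b \<in> B}"

definition left_ideal :: "'a set \<Rightarrow> ('a \<Rightarrow> 'a \<Rightarrow> 'a) \<Rightarrow> 'a set \<Rightarrow> bool" where
  "left_ideal S mult A \<longleftrightarrow> A \<noteq> {} \<and> A \<subseteq> S \<and> set_prod mult S A \<subseteq> A"

definition right_ideal :: "'a set \<Rightarrow> ('a \<Rightarrow> 'a \<Rightarrow> 'a) \<Rightarrow> 'a set \<Rightarrow> bool" where
  "right_ideal S mult A \<longleftrightarrow> A \<noteq> {} \<and> A \<subseteq> S \<and> set_prod mult A S \<subseteq> A"

definition semiprime :: "'a set \<Rightarrow> ('a \<Rightarrow> 'a \<Rightarrow> 'a) \<Rightarrow> 'a set \<Rightarrow> bool" where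
  "semiprime S mult A \<longleftrightarrow> A \<noteq> {} \<and> A \<subseteq> S \<and> (\<forall>a\<in>S. mult a a \<in> A \<longrightarrow> a \<in> A)"

definition intra_regular :: "'a set \<Rightarrow> ('a \<Rightarrow> 'a \<Rightarrow> 'a) \<Rightarrow> bool" where
  "intra_regular S mult \<longleftrightarrow> (\<forall>a\<in>S. \<exists>x\<in>S. \<exists>y\<in>S. a = mult (mult x (mult a a)) y)"

end

theory Submission
  imports Defs
begin

text \<open>
  The whole set \<open>S\<close> is a semiprime right ideal, so the hypothesis with \<open>R = S\<close> reads
  \<open>S = L \<union> S = LS\<close>: multiplying any left ideal on the right by \<open>S\<close> gives everything.
  It therefore suffices to feed in the left ideal \<open>L = Sa\<^sup>2\<close>, because \<open>a \<in> (Sa\<^sup>2)S\<close> is exactly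
  intra-regularity at \<open>a\<close>. That a set \<open>Sa\<close> is a left ideal is not immediate
  without associativity; it comes from the identity \<open>s(ta) = ((te)s)a\<close>, which a left identity
  \<open>e\<close> makes available through the medial law.
\<close>

lemma (in la_semigroup) medial:
  assumes "a \<in> S" "b \<in> S" "c \<in> S" "d \<in> S"
  shows "(a \<cdot> b) \<cdot> (c \<cdot> d) = (a \<cdot> c) \<cdot> (b \<cdot> d)"
proof -
  have "(a \<cdot> b) \<cdot> (c \<cdot> d) = ((c \<cdot> d) \<cdot> b) \<cdot> a"
    using left_invertive[of a b "c \<cdot> d"] assms by (simp add: closed)
  also have "\<dots> = ((b \<cdot> d) \<cdot> c) \<cdot> a"
    using left_invertive[of c d b] assms by simp
  also have "\<dots> = (a \<cdot> c) \<cdot> (b \<cdot> d)"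
    using left_invertive[of "b \<cdot> d" c a] assms by (simp add: closed)
  finally show ?thesis .
qed

lemma (in la_semigroup) left_factors_commute:
  assumes "left_identity S (\<cdot>) e" "a \<in> S" "b \<in> S" "c \<in> S"
  shows "a \<cdot> (b \<cdot> c) = b \<cdot> (a \<cdot> c)"
  using medial[of e a b c] assms by (simp add: left_identity_def)

text \<open>
  This replaces associativity: iterated left multiplications of \<open>a\<close> collapse to a single one,
  at the price of twisting the multiplier.
\<close>

lemma (in la_semigroup) left_multiplications_collapse:
  assumes e: "left_identity S (\<cdot>) e" and "s \<in> S" "t \<in> S" "a \<in> S"
  shows "s \<cdot> (t \<cdot> a) = ((t \<cdot> e) \<cdot> s) \<cdot> a"
proof -
  have eS: "e \<in> S" and es: "e \<cdot> s = s"
    using assms by (auto simp: left_identity_def)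
  have "s \<cdot> (t \<cdot> a) = t \<cdot> (s \<cdot> a)"
    using assms by (rule left_factors_commute)
  also have "s \<cdot> a = (a \<cdot> s) \<cdot> e"
    using left_invertive[of e s a] assms eS es by simp
  also have "t \<cdot> ((a \<cdot> s) \<cdot> e) = (a \<cdot> s) \<cdot> (t \<cdot> e)"
    using left_factors_commute[OF e] assms eS by (simp add: closed)
  also have "\<dots> = ((t \<cdot> e) \<cdot> s) \<cdot> a"
    using left_invertive[of a s "t \<cdot> e"] assms eS by (simp add: closed)
  finally show ?thesis .
qed

lemma (in la_semigroup) left_ideal_left_multiples:
  assumes e: "left_identity S (\<cdot>) e" and a: "a \<in> S"
  shows "left_ideal S (\<cdot>) (set_prod (\<cdot>) S {a})"
  unfolding left_ideal_def
proof (intro conjI)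
  show "set_prod (\<cdot>) S {a} \<noteq> {}"
    using nonempty by (auto simp: set_prod_def)
  show "set_prod (\<cdot>) S {a} \<subseteq> S"
    using a by (auto simp: set_prod_def closed)
  show "set_prod (\<cdot>) S (set_prod (\<cdot>) S {a}) \<subseteq> set_prod (\<cdot>) S {a}"
  proof
    fix z assume "z \<in> set_prod (\<cdot>) S (set_prod (\<cdot>) S {a})"
    then obtain s t where st: "s \<in> S" "t \<in> S" and z: "z = s \<cdot> (t \<cdot> a)"
      by (auto simp: set_prod_def)
    have "z = ((t \<cdot> e) \<cdot> s) \<cdot> a"
      using left_multiplications_collapse[OF e st a] z by simp
    moreover have "(t \<cdot> e) \<cdot> s \<in> S"
      using e st by (simp add: closed left_identity_def)
    ultimately show "z \<in> set_prod (\<cdot>) S {a}"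
      by (auto simp: set_prod_def)
  qed
qed

lemma (in la_semigroup) right_ideal_carrier: "right_ideal S (\<cdot>) S"
  using nonempty by (auto simp: right_ideal_def set_prod_def closed)

lemma (in la_semigroup) semiprime_carrier: "semiprime S (\<cdot>) S"
  using nonempty by (simp add: semiprime_def)

theorem theorem5:
  fixes S :: "'a set" and mult :: "'a \<Rightarrow> 'a \<Rightarrow> 'a"
  assumes "la_semigroup S mult"
    and "\<exists>e. left_identity S mult e"
    and "\<And>L R. \<lbrakk>left_ideal S mult L; right_ideal S mult R; semiprime S mult R\<rbrakk>
           \<Longrightarrow> L \<union> R = set_prod mult L R"
  shows "intra_regular S mult"
  unfolding intra_regular_def
proof
  interpret la_semigroup S mult by (rule assms(1))
  fix a assume a: "a \<in> S"
  obtain e where e: "left_identity S mult e"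
    using assms(2) by blast
  let ?L = "set_prod mult S {mult a a}"
  have "left_ideal S mult ?L"
    using e a by (intro left_ideal_left_multiples closed)
  then have "?L \<union> S = set_prod mult ?L S"
    by (rule assms(3)[OF _ right_ideal_carrier semiprime_carrier])
  with a have "a \<in> set_prod mult ?L S"
    by blast
  then obtain z y where z: "z \<in> ?L" and y: "y \<in> S" and azy: "a = mult z y"
    unfolding set_prod_def[of mult ?L S] mem_Collect_eq by (elim exE conjE)
  from z obtain x where "x \<in> S" "z = mult x (mult a a)"
    by (auto simp: set_prod_def)
  with y azy show "\<exists>x\<in>S. \<exists>y\<in>S. a = mult (mult x (mult a a)) y"
    by metis
qed

end
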